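(* For any odd integer $p\ge 3$, let $\mathcal{A}$ be the algorithm for odd $p$ described in the context with the growth factor $a=1+\sqrt{\frac{2}{p+1}}$, so that $CR_{\mathcal{A}}=2p+3+\sqrt{8(p+1)}$. For any $\varepsilon>0$, let $\mathcal{B}$ be the modified algorithm obtained from $\mathcal{A}$ by replacing every call ThoroughSearch$(x_{init},\delta,p)$ with the analogous call CompliantThoroughSearch$(x_{init},\delta,p,c,\varepsilon)$, where $c=CR_{\mathcal{A}}$. Then $\mathcal{B}$ achieves competitive ratio $CR_{\mathcal{B}}=CR_{\mathcal{A}}+\varepsilon$ while making $O\!\left(\log\left(\frac p\varepsilon\right)\right)$ calls to CellSearch per round.
   Context: **Problem.** A point-like searcher starts at the origin of the real line at time $0$ and moves with speed at most $1$. A stationary target is at an unknown coordinate at distance $d\ge 1$ from the origin. The searcher has $p$ search modes, and a target is detected only when the searcher passes through its location in the (unknown) correct mode. The searcher may switch direction and mode instantaneously. A coordinate $x$ is *explored* by time $t$ if the searcher has passed through $x$ in each of the $p$ modes at or before time $t$. By convention every $x$ with $|x|<1$ counts as explored at time $0$. **Competitive ratio.** For an algorithm $\mathcal{A}$ (analyzed as if it never stops), let $T_{\mathcal{A}}(x)=\inf\{t\ge 0: x \text{ is explored by time } t\}$, $CR_{\mathcal{A}}(x)=T_{\mathcal{A}}(x)/|x|$, and $CR_{\mathcal{A}}=\sup_x CR_{\mathcal{A}}(x)$, the supremum being effectively over $|x|\ge 1$. **CellSearch.** CellSearch$(x_{init},\delta,p)$, called when the searcher is at $x_{init}\ne0$: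 for $i=0,\dots,p-1$ in order, the searcher travels at speed $1$ from its current position $y$ to $y+(-1)^i\delta\cdot\mathrm{sign}(x_{init})$ while searching in mode $i$. (For odd $p$ it ends at $x_{init}+\delta\cdot\mathrm{sign}(x_{init})$.) **ThoroughSearch for odd $p$.** ThoroughSearch$(x_{init},\delta,p)$: the searcher travels from $x_{init}\neq0$ to $x_{init}+\delta\cdot\mathrm{sign}(x_{init})$ at constant speed $\frac1p$ while searching in all $p$ modes simultaneously, so each point is explored when it is reached. **Algorithm for odd $p$** (input: $p$ and a growth factor $a>1$; it terminates upon detecting the target). For rounds $i=0,1,2,\dots$: set $x=(-1)^i a^{i-1}$; go from the origin to $x$ at speed $1$; call ThoroughSearch$(x,\,a^{i+1}-a^{i-1},\,p)$; return to the origin at speed $1$. **CompliantThoroughSearch for odd $p$.** CompliantThoroughSearch$(x_{init},\delta,p,c,\varepsilon)$: set $x\leftarrow 0$ and $s\leftarrow\frac{\varepsilon|x_{init}|}{p-1}$. While $x<\delta$: set $\Delta x\leftarrow\min(s,\delta-x)$; call CellSearch$(x_{init}+x\cdot\mathrm{sign}(x_{init}),\Delta x,p)$; set $x\leftarrow x+\Delta x$; set $s\leftarrow s\cdot\frac{c+\varepsilon-1}{p-1}$.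
   Formalization: CR_B = CR_A+ε is proved for ε ≤ (p−1)(a²−1), only ≤ for larger ε, where each round is one CellSearch and equality fails. Since log(p/ε) is near 0 or negative for ε near or above p, the call bound is O(max(1, log(p/ε))), and O(log(p/ε)) on p/ε ≥ K for each K > 1. *)

theory Defs
  imports
    Complex_Main
    "HOL-Library.Extended_Real"
    "HOL-Library.While_Combinator"
    "HOL-Library.Landau_Symbols"
begin

text \<open>
  A leg is a straight movement at constant speed during which the given set of modes is active.
  The legs of a search procedure are listed in chronological order, and an algorithm
  assigns to each round its list of legs.
\<close>

datatype leg =
  Leg (leg_start: real) (leg_end: real) (leg_speed: real) (leg_modes: "nat set")

type_synonym algorithm = "nat \<Rightarrow> leg list"

definition leg_duration :: "leg \<Rightarrow> real" where
  "leg_duration l = \<bar>leg_end l - leg_start l\<bar> / leg_speed l"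

definition leg_position :: "leg \<Rightarrow> real \<Rightarrow> real" where
  "leg_position l \<tau> = leg_start l + sgn (leg_end l - leg_start l) * leg_speed l * \<tau>"

definition total_duration :: "leg list \<Rightarrow> real" where
  "total_duration ls = (\<Sum>l\<leftarrow>ls. leg_duration l)"

definition leg_start_time :: "algorithm \<Rightarrow> nat \<Rightarrow> nat \<Rightarrow> real" where
  "leg_start_time A i k = (\<Sum>j<i. total_duration (A j)) + total_duration (take k (A i))"

text \<open>
  Legs are closed: at a turning point the searcher counts as being in the modes of both
  adjacent legs.
\<close>

definition searched_at :: "algorithm \<Rightarrow> nat \<Rightarrow> real \<Rightarrow> real \<Rightarrow> bool" where
  "searched_at A m x t \<longleftrightarrow>
     (\<exists>i k \<tau>. k < length (A i) \<and> m \<in> leg_modes (A i ! k) \<and>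
        0 \<le> \<tau> \<and> \<tau> \<le> leg_duration (A i ! k) \<and>
        leg_position (A i ! k) \<tau> = x \<and> t = leg_start_time A i k + \<tau>)"

definition explored_by :: "nat \<Rightarrow> algorithm \<Rightarrow> real \<Rightarrow> real \<Rightarrow> bool" where
  "explored_by p A x t \<longleftrightarrow> \<bar>x\<bar> < 1 \<or> (\<forall>m<p. \<exists>t'\<le>t. searched_at A m x t')"

text \<open>The value is infinite for a point that is never explored.\<close>

definition exploration_time :: "nat \<Rightarrow> algorithm \<Rightarrow> real \<Rightarrow> ereal" where
  "exploration_time p A x = Inf (ereal ` {t. 0 \<le> t \<and> explored_by p A x t})"

definition competitive_ratio :: "nat \<Rightarrow> algorithm \<Rightarrow> ereal" where
  "competitive_ratio p A = (SUP x\<in>{x::real. 1 \<le> \<bar>x\<bar>}. exploration_time p A x / ereal \<bar>x\<bar>)"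


fun cell_position :: "real \<Rightarrow> real \<Rightarrow> nat \<Rightarrow> real" where
  "cell_position x_init \<delta> 0 = x_init"
| "cell_position x_init \<delta> (Suc i) = cell_position x_init \<delta> i + (-1) ^ i * \<delta> * sgn x_init"

definition cell_search :: "real \<Rightarrow> real \<Rightarrow> nat \<Rightarrow> leg list" where
  "cell_search x_init \<delta> p =
     map (\<lambda>i. Leg (cell_position x_init \<delta> i) (cell_position x_init \<delta> (Suc i)) 1 {i}) [0..<p]"

definition thorough_search :: "real \<Rightarrow> real \<Rightarrow> nat \<Rightarrow> leg list" where
  "thorough_search x_init \<delta> p = [Leg x_init (x_init + \<delta> * sgn x_init) (1 / real p) {..<p}]"

text \<open>The loop state consists of x, s and the arguments of the cell searches called so far.\<close>

definition compliant_cells ::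
    "real \<Rightarrow> real \<Rightarrow> nat \<Rightarrow> real \<Rightarrow> real \<Rightarrow> (real \<times> real) list" where
  "compliant_cells x_init \<delta> p c \<epsilon> =
     (case while
        (\<lambda>(x, s, cells). x < \<delta>)
        (\<lambda>(x, s, cells).
           let \<Delta>x = min s (\<delta> - x)
           in (x + \<Delta>x,
               s * ((c + \<epsilon> - 1) / (real p - 1)),
               cells @ [(x_init + x * sgn x_init, \<Delta>x)]))
        (0, \<epsilon> * \<bar>x_init\<bar> / (real p - 1), [])
      of (x, s, cells) \<Rightarrow> cells)"

definition compliant_thorough_search ::
    "real \<Rightarrow> real \<Rightarrow> nat \<Rightarrow> real \<Rightarrow> real \<Rightarrow> leg list" where
  "compliant_thorough_search x_init \<delta> p c \<epsilon> =
     concat (map (\<lambda>(y, \<Delta>x). cell_search y \<Delta>x p) (compliant_cells x_init \<delta> p c \<epsilon>))"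


definition round_start :: "real \<Rightarrow> nat \<Rightarrow> real" where
  "round_start a i = (-1) ^ i * a powi (int i - 1)"

definition round_extent :: "real \<Rightarrow> nat \<Rightarrow> real" where
  "round_extent a i = a powi (int i + 1) - a powi (int i - 1)"

text \<open>
  The argument search is the procedure called on the starting point and the extent of each
  round.  The legs to and from the searched interval have no active mode.
\<close>

definition zigzag :: "(real \<Rightarrow> real \<Rightarrow> leg list) \<Rightarrow> real \<Rightarrow> algorithm" where
  "zigzag search a i =
     (let x = round_start a i; legs = search x (round_extent a i)
      in [Leg 0 x 1 {}] @ legs @ [Leg (leg_end (last legs)) 0 1 {}])"

definition odd_algorithm :: "nat \<Rightarrow> real \<Rightarrow> algorithm" where
  "odd_algorithm p a = zigzag (\<lambda>x \<delta>. thorough_search x \<delta> p) a"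

definition compliant_algorithm :: "nat \<Rightarrow> real \<Rightarrow> real \<Rightarrow> real \<Rightarrow> algorithm" where
  "compliant_algorithm p a c \<epsilon> = zigzag (\<lambda>x \<delta>. compliant_thorough_search x \<delta> p c \<epsilon>) a"

definition cell_search_calls :: "nat \<Rightarrow> real \<Rightarrow> real \<Rightarrow> real \<Rightarrow> nat \<Rightarrow> nat" where
  "cell_search_calls p a c \<epsilon> i =
     length (compliant_cells (round_start a i) (round_extent a i) p c \<epsilon>)"


definition growth :: "nat \<Rightarrow> real" where
  "growth p = 1 + sqrt (2 / (real p + 1))"

definition alg_A :: "nat \<Rightarrow> algorithm" where
  "alg_A p = odd_algorithm p (growth p)"

definition ratio_A :: "nat \<Rightarrow> real" where
  "ratio_A p = real_of_ereal (competitive_ratio p (alg_A p))"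

definition alg_B :: "nat \<Rightarrow> real \<Rightarrow> algorithm" where
  "alg_B p \<epsilon> = compliant_algorithm p (growth p) (ratio_A p) \<epsilon>"

definition calls_B :: "nat \<Rightarrow> real \<Rightarrow> nat \<Rightarrow> nat" where
  "calls_B p \<epsilon> i = cell_search_calls p (growth p) (ratio_A p) \<epsilon> i"

end

(*
  Let r = a^(i-1) be the distance at which round i starts searching.  Both algorithms spend
  p (a^2 - 1) r on the searched part, so round i starts at time (c - 1)(r - 1/a) with
  c - 1 = ((p+1) a^2 - (p-1)) / (a - 1), and the points just beyond distance r show that the
  ratio of the original algorithm is c.

  In the compliant version let E(k) be the length covered by the first k cells.  The last mode
  reaches the points just beyond r + E(k) only after a search time of p E(k) + (p-1)(E(k+1) - E(k)),
  so ratio c + eps amounts to (p-1) E(k+1) <= (c + eps - 1) E(k) + eps r.  The geometric cell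
  lengths make this an equality until the last cell is truncated; if the very first cell is
  not truncated, the case k = 0 shows that the bound is sharp.  The quotient
  (c + eps - 1) / (p - 1) of consecutive lengths is at least 2, hence logarithmically many
  cells suffice.
*)
theory Submission
  imports Defs
begin

subsection \<open>Searching with a list of legs\<close>

definition leg_searches :: "leg \<Rightarrow> nat \<Rightarrow> real \<Rightarrow> real \<Rightarrow> bool" where
  "leg_searches l m x \<tau> \<longleftrightarrow>
     m \<in> leg_modes l \<and> 0 \<le> \<tau> \<and> \<tau> \<le> leg_duration l \<and> leg_position l \<tau> = x"

text \<open>Times are relative to the start of the list, so appending, concatenating and passing to
  a later round only shift the argument t.\<close>

definition searched_in :: "leg list \<Rightarrow> nat \<Rightarrow> real \<Rightarrow> real \<Rightarrow> bool" where
  "searched_in ls m x t \<longleftrightarrow>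
     (\<exists>k<length ls. leg_searches (ls ! k) m x (t - total_duration (take k ls)))"

lemma total_duration_simps [simp]:
  "total_duration [] = 0"
  "total_duration (l # ls) = leg_duration l + total_duration ls"
  "total_duration (ls @ ls') = total_duration ls + total_duration ls'"
  by (simp_all add: total_duration_def)

lemma total_duration_concat:
  "total_duration (concat lss) = (\<Sum>ls\<leftarrow>lss. total_duration ls)"
  by (induction lss) simp_all

lemma searched_in_Nil [simp]: "\<not> searched_in [] m x t"
  by (simp add: searched_in_def)

lemma searched_in_Cons [simp]:
  "searched_in (l # ls) m x t \<longleftrightarrow>
     leg_searches l m x t \<or> searched_in ls m x (t - leg_duration l)"
  by (simp add: searched_in_def Ex_less_Suc2 diff_diff_eq del: ex_simps)

lemma searched_in_append [simp]:
  "searched_in (ls @ ls') m x t \<longleftrightarrow>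
     searched_in ls m x t \<or> searched_in ls' m x (t - total_duration ls)"
  by (induction ls arbitrary: t) (simp_all add: diff_diff_eq)

lemma searched_in_concat:
  "searched_in (concat lss) m x t \<longleftrightarrow>
     (\<exists>k<length lss. searched_in (lss ! k) m x (t - total_duration (concat (take k lss))))"
  by (induction lss arbitrary: t) (simp_all add: Ex_less_Suc2 diff_diff_eq del: ex_simps)

lemma searched_at_iff:
  "searched_at A m x t \<longleftrightarrow>
     (\<exists>i. searched_in (A i) m x (t - (\<Sum>j<i. total_duration (A j))))"
proof -
  have "(\<exists>\<tau>. m \<in> leg_modes l \<and> 0 \<le> \<tau> \<and> \<tau> \<le> leg_duration l \<and> leg_position l \<tau> = x \<and>
           t = leg_start_time A i k + \<tau>) \<longleftrightarrow>
        leg_searches l m x (t - (\<Sum>j<i. total_duration (A j)) - total_duration (take k (A i)))"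
    for l i k
  proof -
    have "t = leg_start_time A i k + \<tau> \<longleftrightarrow>
        \<tau> = t - (\<Sum>j<i. total_duration (A j)) - total_duration (take k (A i))" for \<tau>
      by (auto simp: leg_start_time_def)
    then show ?thesis
      unfolding leg_searches_def by auto
  qed
  then show ?thesis
    unfolding searched_at_def searched_in_def by metis
qed

lemma idle_leg_searches [simp]: "\<not> leg_searches (Leg x y v {}) m z t"
  by (simp add: leg_searches_def)

subsection \<open>Bounds on the competitive ratio\<close>

lemma competitive_ratio_le:
  assumes "\<And>x. 1 \<le> \<bar>x\<bar> \<Longrightarrow> \<forall>m<p. \<exists>t\<le>C * \<bar>x\<bar>. searched_at A m x t"
    and "0 \<le> C"
  shows "competitive_ratio p A \<le> ereal C"
  unfolding competitive_ratio_def
proof (rule SUP_least)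
  fix x :: real
  assume "x \<in> {x. 1 \<le> \<bar>x\<bar>}"
  then have x: "1 \<le> \<bar>x\<bar>" by simp
  have "exploration_time p A x \<le> ereal (C * \<bar>x\<bar>)"
    unfolding exploration_time_def
    using assms(1)[OF x] assms(2) x by (intro Inf_lower) (auto simp: explored_by_def)
  then have "exploration_time p A x / ereal \<bar>x\<bar> \<le> ereal (C * \<bar>x\<bar>) / ereal \<bar>x\<bar>"
    using x by (intro ereal_divide_right_mono) auto
  also have "\<dots> = ereal C"
    using x by auto
  finally show "exploration_time p A x / ereal \<bar>x\<bar> \<le> ereal C" .
qed

text \<open>A single late mode suffices: a point at distance at least 1 is explored only after every
  mode has passed it.\<close>

lemma competitive_ratio_ge:
  assumes "1 \<le> \<bar>x\<bar>" "m < p"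
    and late: "\<And>t. searched_at A m x t \<Longrightarrow> T \<le> t"
  shows "ereal (T / \<bar>x\<bar>) \<le> competitive_ratio p A"
proof -
  have "ereal T \<le> exploration_time p A x"
    unfolding exploration_time_def
  proof (rule Inf_greatest)
    fix e
    assume "e \<in> ereal ` {t. 0 \<le> t \<and> explored_by p A x t}"
    then obtain t where "e = ereal t" "explored_by p A x t" by auto
    then show "ereal T \<le> e"
      using assms by (force simp: explored_by_def)
  qed
  then have "ereal T / ereal \<bar>x\<bar> \<le> exploration_time p A x / ereal \<bar>x\<bar>"
    using assms by (intro ereal_divide_right_mono) auto
  also have "\<dots> \<le> competitive_ratio p A"
    unfolding competitive_ratio_def using assms by (intro SUP_upper) auto
  finally show ?thesis
    using assms(1) by (simp split: if_splits)
qed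

subsection \<open>Zigzag algorithms\<close>

lemma round_start_eq: "a \<noteq> 0 \<Longrightarrow> round_start a i = (- a) ^ i / a"
  by (simp add: round_start_def power_int_diff power_minus[of a])

lemma round_extent_eq:
  assumes "a > 0"
  shows "round_extent a i = (a\<^sup>2 - 1) * \<bar>round_start a i\<bar>"
  using assms
  by (simp add: round_extent_def round_start_eq power_int_diff power_int_add power_abs
      power2_eq_square field_simps)

lemma exists_power_between:
  fixes a y :: real
  assumes "a > 1" "y \<ge> 1"
  shows "\<exists>n. a ^ n \<le> y \<and> y < a ^ Suc n"
proof -
  obtain n where "y < a ^ n"
    using real_arch_pow assms(1) by blast
  moreover have "\<not> y < a ^ 0"
    using assms by simp
  ultimately show ?thesis
    using ex_least_nat_less[of "\<lambda>n. y < a ^ n" n] by (meson lessI linorder_not_less order_refl)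
qed

text \<open>If |z| lies between a^n and a^(n+1), then rounds n and n+1 both span the distance |z|,
  on opposite sides of the origin. The sign of z selects one of them.\<close>

lemma round_covers:
  fixes a z :: real
  assumes a: "a > 1" and z: "\<bar>z\<bar> \<ge> 1"
  shows "\<exists>i. \<exists>v\<in>{1..a\<^sup>2}. z = v * round_start a i"
proof -
  obtain n where n: "a ^ n \<le> \<bar>z\<bar>" "\<bar>z\<bar> < a ^ Suc n"
    using exists_power_between[OF a z] by auto
  obtain i where i: "i = n \<or> i = Suc n" and s: "z = \<bar>z\<bar> * (-1) ^ i"
  proof (cases "z = \<bar>z\<bar> * (-1) ^ n")
    case True
    then show ?thesis using that[of n] by blast
  next
    case False
    then have "z = \<bar>z\<bar> * (-1) ^ Suc n"
      by (cases "even n"; cases "z \<ge> 0") auto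
    then show ?thesis using that[of "Suc n"] by blast
  qed
  define v where "v = \<bar>z\<bar> * a / a ^ i"
  have "v * round_start a i = z"
  proof -
    have "(- a) ^ i = (-1) ^ i * a ^ i"
      by (rule power_minus)
    then show ?thesis
      using a s by (simp add: v_def round_start_eq)
  qed
  moreover have "v \<in> {1..a\<^sup>2}"
  proof -
    have "a ^ n * 1 \<le> \<bar>z\<bar> * a"
      using n a by (intro mult_mono) auto
    moreover have "\<bar>z\<bar> * a \<le> a\<^sup>2 * a ^ n"
      using n a by (simp add: power2_eq_square mult.commute mult.left_commute)
    moreover have "a * a ^ n \<le> \<bar>z\<bar> * a" "\<bar>z\<bar> * a \<le> a\<^sup>2 * (a * a ^ n)"
    proof -
      show "a * a ^ n \<le> \<bar>z\<bar> * a"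
        using n a by (simp add: mult.commute)
      have "1 * (a * a ^ n) \<le> a * (a * a ^ n)"
        using a by (intro mult_right_mono) auto
      then have "\<bar>z\<bar> \<le> a * (a * a ^ n)"
        using n(2) by simp
      then have "\<bar>z\<bar> * a \<le> (a * (a * a ^ n)) * a"
        using a by (intro mult_right_mono) auto
      then show "\<bar>z\<bar> * a \<le> a\<^sup>2 * (a * a ^ n)"
        by (simp add: power2_eq_square mult_ac)
    qed
    ultimately show ?thesis
      using i a by (auto simp: v_def field_simps)
  qed
  ultimately show ?thesis by metis
qed

text \<open>The starts of rounds are powers of -a divided by a. Two different rounds on the same
  side therefore have starting points that differ by an even power of a, hence by a factor of at
  least a^2.\<close>

lemma even_power_ge_square:
  fixes a :: real
  assumes "a > 1" "k > 0" "(- a) ^ k > 0"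
  shows "a\<^sup>2 \<le> (- a) ^ k"
proof -
  have "even k"
    using assms by (metis less_irrefl neg_less_0_iff_less not_less_iff_gr_or_eq
        order_less_trans power_minus_odd zero_less_one zero_less_power)
  then have "2 \<le> k"
    using assms(2) by presburger
  then show ?thesis
    using \<open>even k\<close> assms(1) by (simp add: power_increasing)
qed

text \<open>Intervals of different rounds on the same side meet at most in end points, because the
  larger one starts at least a factor a^2 further out. The lower bound on the ratio needs this to
  exclude an earlier visit of the test point in another round.\<close>

lemma round_unique:
  fixes a v w :: real
  assumes a: "a > 1" and v: "1 < v" "v < a\<^sup>2" and w: "w \<in> {1..a\<^sup>2}"
    and eq: "v * round_start a i = w * round_start a j"
  shows "i = j"
proof -
  have *: "a\<^sup>2 * w' \<le> v'"
    if "k < l" "v' * (- a) ^ k = w' * (- a) ^ l" "v' > 0" "w' > 0" for k l v' w'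
  proof -
    have "(- a) ^ l = (- a) ^ k * (- a) ^ (l - k)"
      using that(1) by (simp flip: power_add)
    then have v': "v' = w' * (- a) ^ (l - k)"
      using that(2) a by simp
    then have "(- a) ^ (l - k) > 0"
      using that by (metis zero_less_mult_pos)
    then have "a\<^sup>2 \<le> (- a) ^ (l - k)"
      using even_power_ge_square[OF a] that(1) by simp
    then show ?thesis
      using v' that(4) by (simp add: mult.commute)
  qed
  have eq': "v * (- a) ^ i = w * (- a) ^ j"
    using eq a by (simp add: round_start_eq)
  have "1 < a\<^sup>2"
    using v by simp
  then have "a\<^sup>2 * 1 \<le> a\<^sup>2 * w" "a\<^sup>2 * 1 < a\<^sup>2 * v"
    using a v w by (intro mult_left_mono mult_strict_left_mono; simp)+
  then show ?thesis
    using *[of i j v w] *[of j i w v] eq' v w by (cases i j rule: linorder_cases) auto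
qed

section \<open>Schedule and competitive ratio for an abstract search procedure\<close>

locale round_search =
  fixes p :: nat and a :: real and search :: "real \<Rightarrow> real \<Rightarrow> leg list"
  assumes p_pos: "p > 0" and a_gt_1: "a > 1"
    and duration: "x \<noteq> 0 \<Longrightarrow>
      total_duration (search x ((a\<^sup>2 - 1) * \<bar>x\<bar>)) = real p * ((a\<^sup>2 - 1) * \<bar>x\<bar>)"
    and final: "x \<noteq> 0 \<Longrightarrow> leg_end (last (search x ((a\<^sup>2 - 1) * \<bar>x\<bar>))) = a\<^sup>2 * x"
    and located: "x \<noteq> 0 \<Longrightarrow> searched_in (search x ((a\<^sup>2 - 1) * \<bar>x\<bar>)) m z t \<Longrightarrow>
      \<exists>v\<in>{1..a\<^sup>2}. z = v * x"
begin

text \<open>A round starting at distance r lasts (p+1) a^2 - (p-1) times r. Division by a - 1 sums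
  the geometric series of the preceding rounds, and the additional 1 is the walk out to the start of
  the current round.\<close>

definition ratio :: real where
  "ratio = 1 + ((real p + 1) * a\<^sup>2 - (real p - 1)) / (a - 1)"

text \<open>This bound later makes the cells of the compliant search at least double in
  length.\<close>

lemma ratio_ge_double: "2 * (real p - 1) \<le> ratio - 1"
proof -
  \<comment> \<open>The right-hand side is the difference of the two sides of the claim after
    multiplication by a - 1.\<close>
  have "0 \<le> (real p - 1) * (a - 1)\<^sup>2 + 2 * a\<^sup>2"
    using p_pos by simp
  then have "2 * (real p - 1) * (a - 1) \<le> (real p + 1) * a\<^sup>2 - (real p - 1)"
    by (simp add: power2_eq_square algebra_simps)
  then show ?thesis
    using a_gt_1 by (simp add: ratio_def field_simps)
qed

lemma ratio_ge: "real p \<le> ratio"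
  using ratio_ge_double p_pos by simp

abbreviation start :: "nat \<Rightarrow> real" where
  "start \<equiv> round_start a"

abbreviation round_time :: "nat \<Rightarrow> real" where
  "round_time i \<equiv> (\<Sum>j<i. total_duration (zigzag search a j))"

lemma abs_start: "\<bar>start i\<bar> = a ^ i / a"
  using a_gt_1 by (simp add: round_start_eq power_abs)

lemma start_nonzero: "start i \<noteq> 0"
  using a_gt_1 by (simp add: round_start_eq)

lemma zigzag_eq:
  "zigzag search a i =
     Leg 0 (start i) 1 {} # search (start i) ((a\<^sup>2 - 1) * \<bar>start i\<bar>) @ [Leg (a\<^sup>2 * start i) 0 1 {}]"
  using final[OF start_nonzero] a_gt_1 by (simp add: zigzag_def Let_def round_extent_eq)

lemma round_duration:
  "total_duration (zigzag search a i) = ((real p + 1) * a\<^sup>2 - (real p - 1)) * \<bar>start i\<bar>"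
  by (simp add: zigzag_eq duration[OF start_nonzero] leg_duration_def abs_mult)
    (simp add: algebra_simps)

text \<open>Each round lasts \<open>ratio - 1\<close> times the increase of the starting distance,
  so the sum telescopes. The subtracted 1/a is the starting distance of round 0.\<close>

lemma round_time_eq: "round_time i = (ratio - 1) * (\<bar>start i\<bar> - 1 / a)"
proof (induction i)
  case 0
  show ?case using a_gt_1 by (simp add: abs_start)
next
  case (Suc i)
  have "total_duration (zigzag search a i) = (ratio - 1) * ((a - 1) * \<bar>start i\<bar>)"
    using a_gt_1 by (simp add: round_duration ratio_def)
  also have "(a - 1) * \<bar>start i\<bar> = \<bar>start (Suc i)\<bar> - \<bar>start i\<bar>"
    using a_gt_1 by (simp add: abs_start field_simps)
  finally show ?case
    using Suc by (simp add: algebra_simps)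
qed

lemma searched_at_zigzag:
  "searched_at (zigzag search a) m z t \<longleftrightarrow>
     (\<exists>i. searched_in (search (start i) ((a\<^sup>2 - 1) * \<bar>start i\<bar>)) m z
        (t - (round_time i + \<bar>start i\<bar>)))"
  by (simp add: searched_at_iff zigzag_eq[of i for i] leg_duration_def diff_diff_eq)

text \<open>At most \<open>ratio * \<bar>x\<bar>\<close> has elapsed when the search at x begins,
  and the point v * x may be explored as late as (ratio + eps) v |x|. The difference is the time
  allowed inside the search, which no longer depends on the round.\<close>

lemma ratio_upper_bound:
  assumes "0 \<le> \<epsilon>"
    and early: "\<And>x v m. x \<noteq> 0 \<Longrightarrow> v \<in> {1..a\<^sup>2} \<Longrightarrow> m < p \<Longrightarrow>
      \<exists>t\<le>((ratio + \<epsilon>) * v - ratio) * \<bar>x\<bar>.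
        searched_in (search x ((a\<^sup>2 - 1) * \<bar>x\<bar>)) m (v * x) t"
  shows "competitive_ratio p (zigzag search a) \<le> ereal (ratio + \<epsilon>)"
proof (rule competitive_ratio_le)
  show "0 \<le> ratio + \<epsilon>"
    using ratio_ge assms(1) by linarith
  fix z :: real
  assume "1 \<le> \<bar>z\<bar>"
  then obtain i v where v: "v \<in> {1..a\<^sup>2}" and z: "z = v * start i"
    using round_covers[OF a_gt_1] by metis
  have "round_time i \<le> (ratio - 1) * \<bar>start i\<bar>"
    unfolding round_time_eq using ratio_ge p_pos a_gt_1 by (intro mult_left_mono) auto
  then have *: "round_time i + \<bar>start i\<bar> \<le> ratio * \<bar>start i\<bar>"
    by (simp add: algebra_simps)
  show "\<forall>m<p. \<exists>t\<le>(ratio + \<epsilon>) * \<bar>z\<bar>. searched_at (zigzag search a) m z t"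
  proof (intro allI impI)
    fix m
    assume "m < p"
    from early[OF start_nonzero v this] obtain t
      where t: "t \<le> ((ratio + \<epsilon>) * v - ratio) * \<bar>start i\<bar>"
        and s: "searched_in (search (start i) ((a\<^sup>2 - 1) * \<bar>start i\<bar>)) m (v * start i) t"
      by blast
    let ?t = "t + (round_time i + \<bar>start i\<bar>)"
    have "?t \<le> (ratio + \<epsilon>) * \<bar>z\<bar>"
      using t * v by (simp add: z abs_mult algebra_simps)
    moreover have "searched_at (zigzag search a) m z ?t"
      unfolding searched_at_zigzag z using s by (intro exI[of _ i]) simp
    ultimately show "\<exists>t\<le>(ratio + \<epsilon>) * \<bar>z\<bar>. searched_at (zigzag search a) m z t"
      by blast
  qed
qed

text \<open>The supremum is not attained: it is approached just beyond the start of late rounds.\<close>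

lemma ratio_lower_bound:
  assumes \<theta>: "0 < \<theta>" "\<theta> \<le> a\<^sup>2 - 1" and "m < p"
    and late: "\<And>x v t. x \<noteq> 0 \<Longrightarrow> v \<in> {1<..<1 + \<theta>} \<Longrightarrow>
      searched_in (search x ((a\<^sup>2 - 1) * \<bar>x\<bar>)) m (v * x) t \<Longrightarrow> \<epsilon> * \<bar>x\<bar> \<le> t"
  shows "ereal (ratio + \<epsilon>) \<le> competitive_ratio p (zigzag search a)"
proof -
  \<comment> \<open>The test points \<open>v i * start i\<close> tend to the start of their round in
    relative terms, and \<open>f i\<close> is the ratio they force. The shift by two keeps
    \<open>v i\<close> strictly below 1 + \<theta>. The term (1/a)^i is the constant 1/a of
    \<open>round_time_eq\<close> relative to the starting distance.\<close>
  define v where "v = (\<lambda>i. 1 + \<theta> * inverse (real (Suc (Suc i))))"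
  define f where "f = (\<lambda>i. (1 + \<epsilon> + (ratio - 1) * (1 - (1 / a) ^ i)) / v i)"
  have v: "v i \<in> {1<..<1 + \<theta>}" for i
    using \<theta>(1) by (simp add: v_def field_simps add_pos_nonneg)
  \<comment> \<open>Round 0 starts at distance 1/a, inside the zone explored by convention, so only
    rounds from 1 on are used.\<close>
  have bound: "ereal (f i) \<le> competitive_ratio p (zigzag search a)" if "1 \<le> i" for i
  proof -
    have vi: "1 < v i" "v i < a\<^sup>2"
      using v[of i] \<theta>(2) by auto
    have "1 \<le> \<bar>start i\<bar>"
      using that a_gt_1 power_increasing[of 1 i a] by (simp add: abs_start)
    then have "1 * 1 \<le> v i * \<bar>start i\<bar>"
      using vi by (intro mult_mono) auto
    then have "1 \<le> \<bar>v i * start i\<bar>"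
      using vi by (simp add: abs_mult)
    moreover note \<open>m < p\<close>
    moreover have "round_time i + \<bar>start i\<bar> + \<epsilon> * \<bar>start i\<bar> \<le> t"
      if s: "searched_at (zigzag search a) m (v i * start i) t" for t
    proof -
      obtain j where j: "searched_in (search (start j) ((a\<^sup>2 - 1) * \<bar>start j\<bar>)) m (v i * start i)
          (t - (round_time j + \<bar>start j\<bar>))"
        using s unfolding searched_at_zigzag by blast
      then obtain w where "w \<in> {1..a\<^sup>2}" "v i * start i = w * start j"
        using located[OF start_nonzero] by blast
      \<comment> \<open>The factor \<open>v i\<close> lies strictly between 1 and a^2, so no other
        round visits the test point.\<close>
      then have "i = j"
        using round_unique[OF a_gt_1 vi] by blast
      then show ?thesis
        using late[OF start_nonzero v] j by fastforce
    qed
    ultimately have "ereal ((round_time i + \<bar>start i\<bar> + \<epsilon> * \<bar>start i\<bar>) / \<bar>v i * start i\<bar>)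
        \<le> competitive_ratio p (zigzag search a)"
      by (rule competitive_ratio_ge)
    also have "(round_time i + \<bar>start i\<bar> + \<epsilon> * \<bar>start i\<bar>) / \<bar>v i * start i\<bar> = f i"
    proof -
      have "round_time i = (ratio - 1) * (1 - (1 / a) ^ i) * \<bar>start i\<bar>"
        using a_gt_1 by (simp add: round_time_eq abs_start field_simps)
      moreover have "f i * v i = 1 + \<epsilon> + (ratio - 1) * (1 - (1 / a) ^ i)"
        using vi by (simp add: f_def)
      ultimately have "round_time i + \<bar>start i\<bar> + \<epsilon> * \<bar>start i\<bar> = f i * v i * \<bar>start i\<bar>"
        by (simp only:) (simp add: algebra_simps)
      then show ?thesis
        using vi start_nonzero[of i] by (simp add: abs_mult)
    qed
    finally show ?thesis .
  qed
  have "v \<longlonglongrightarrow> 1"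
    unfolding v_def
    using tendsto_add[OF tendsto_const[of 1]
        tendsto_mult_left[OF LIMSEQ_Suc[OF LIMSEQ_inverse_real_of_nat], of \<theta>]] by simp
  then have "f \<longlonglongrightarrow> (1 + \<epsilon> + (ratio - 1) * (1 - 0)) / 1"
    unfolding f_def using a_gt_1 by (intro tendsto_intros) (auto simp: field_simps)
  then have "(\<lambda>i. ereal (f i)) \<longlonglongrightarrow> ereal (ratio + \<epsilon>)"
    by (simp add: add.commute)
  then show ?thesis
    by (rule LIMSEQ_le_const2) (use bound in blast)
qed

end

subsection \<open>The original algorithm\<close>

lemma thorough_search_eq:
  "thorough_search x ((a\<^sup>2 - 1) * \<bar>x\<bar>) p = [Leg x (a\<^sup>2 * x) (1 / real p) {..<p}]"
  by (simp add: thorough_search_def algebra_simps abs_sgn)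

lemma searched_in_thorough_search:
  assumes "p > 0" "a > 1" "x \<noteq> 0"
  shows "searched_in (thorough_search x ((a\<^sup>2 - 1) * \<bar>x\<bar>) p) m z t \<longleftrightarrow>
    m < p \<and> (\<exists>v\<in>{1..a\<^sup>2}. z = v * x \<and> t = real p * ((v - 1) * \<bar>x\<bar>))"
proof -
  have a2: "a\<^sup>2 > 1"
    using assms by simp
  have d: "a\<^sup>2 * x - x = (a\<^sup>2 - 1) * x"
    by (simp add: algebra_simps)
  have dur: "leg_duration (Leg x (a\<^sup>2 * x) (1 / real p) {..<p}) = real p * ((a\<^sup>2 - 1) * \<bar>x\<bar>)"
    using a2 by (simp add: leg_duration_def d abs_mult)
  have pos: "leg_position (Leg x (a\<^sup>2 * x) (1 / real p) {..<p}) t = x + sgn x * (t / real p)"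
    using a2 by (simp add: leg_position_def d sgn_mult)
  have "0 \<le> t \<and> t \<le> real p * ((a\<^sup>2 - 1) * \<bar>x\<bar>) \<and> x + sgn x * (t / real p) = z \<longleftrightarrow>
      (\<exists>v\<in>{1..a\<^sup>2}. z = v * x \<and> t = real p * ((v - 1) * \<bar>x\<bar>))" (is "?L \<longleftrightarrow> ?R")
  proof
    assume L: ?L
    let ?v = "1 + t / (real p * \<bar>x\<bar>)"
    have "?v \<in> {1..a\<^sup>2}"
      using L assms by (simp add: field_simps)
    moreover have "z = ?v * x"
      using L assms by (auto simp: real_sgn_eq field_simps)
    moreover have "t = real p * ((?v - 1) * \<bar>x\<bar>)"
      using assms by simp
    ultimately show ?R by blast
  next
    assume ?R
    then obtain v where v: "v \<in> {1..a\<^sup>2}" "z = v * x" "t = real p * ((v - 1) * \<bar>x\<bar>)"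
      by blast
    have "t \<le> real p * ((a\<^sup>2 - 1) * \<bar>x\<bar>)" "0 \<le> t"
      using v by (auto intro!: mult_left_mono mult_right_mono)
    moreover have "sgn x * (t / real p) = (v - 1) * x"
      using v assms by (simp add: sgn_if)
    ultimately show ?L
      using v(2) by (simp add: algebra_simps)
  qed
  then show ?thesis
    by (auto simp: thorough_search_eq leg_searches_def dur pos)
qed

lemma round_search_thorough:
  assumes "p > 0" "a > 1"
  shows "round_search p a (\<lambda>x \<delta>. thorough_search x \<delta> p)"
proof
  fix x :: real
  assume x: "x \<noteq> 0"
  show "total_duration (thorough_search x ((a\<^sup>2 - 1) * \<bar>x\<bar>) p) = real p * ((a\<^sup>2 - 1) * \<bar>x\<bar>)"
  proof -
    have "a\<^sup>2 * x - x = (a\<^sup>2 - 1) * x"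
      by (simp add: algebra_simps)
    then show ?thesis
      using assms by (simp add: thorough_search_eq leg_duration_def abs_mult)
  qed
  show "leg_end (last (thorough_search x ((a\<^sup>2 - 1) * \<bar>x\<bar>) p)) = a\<^sup>2 * x"
    by (simp add: thorough_search_eq)
  show "\<exists>v\<in>{1..a\<^sup>2}. z = v * x"
    if "searched_in (thorough_search x ((a\<^sup>2 - 1) * \<bar>x\<bar>) p) m z t" for m z t
    using that assms x by (auto simp: searched_in_thorough_search)
qed (use assms in auto)

text \<open>This is the case eps = 0 of both bounds. The search reaches v * x after p (v-1) |x|,
  which is within the allowance because p is at most \<open>ratio\<close>; for the lower bound the
  trivial delay 0 is enough.\<close>

lemma competitive_ratio_odd_algorithm:
  assumes "p > 0" "a > 1"
  shows "competitive_ratio p (odd_algorithm p a) = ereal (round_search.ratio p a)"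
proof -
  interpret round_search p a "\<lambda>x \<delta>. thorough_search x \<delta> p"
    using assms by (rule round_search_thorough)
  have "competitive_ratio p (odd_algorithm p a) \<le> ereal (ratio + 0)"
    unfolding odd_algorithm_def
  proof (rule ratio_upper_bound)
    fix x v :: real and m
    assume x: "x \<noteq> 0" and v: "v \<in> {1..a\<^sup>2}" and "m < p"
    let ?t = "real p * ((v - 1) * \<bar>x\<bar>)"
    have "?t \<le> ratio * ((v - 1) * \<bar>x\<bar>)"
      using ratio_ge v by (intro mult_right_mono) auto
    also have "\<dots> = ((ratio + 0) * v - ratio) * \<bar>x\<bar>"
      by (simp add: algebra_simps)
    finally show "\<exists>t\<le>((ratio + 0) * v - ratio) * \<bar>x\<bar>.
        searched_in (thorough_search x ((a\<^sup>2 - 1) * \<bar>x\<bar>) p) m (v * x) t"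
      using x v \<open>m < p\<close> assms by (auto simp: searched_in_thorough_search)
  qed simp
  moreover have "ereal (ratio + 0) \<le> competitive_ratio p (odd_algorithm p a)"
    unfolding odd_algorithm_def
  proof (rule ratio_lower_bound)
    show "0 < a\<^sup>2 - 1" "a\<^sup>2 - 1 \<le> a\<^sup>2 - 1" "0 < p"
      using assms by auto
    show "0 * \<bar>x\<bar> \<le> t"
      if "x \<noteq> 0" "v \<in> {1<..<1 + (a\<^sup>2 - 1)}"
        "searched_in (thorough_search x ((a\<^sup>2 - 1) * \<bar>x\<bar>) p) 0 (v * x) t" for x v t
      using that assms by (auto simp: searched_in_thorough_search)
  qed
  ultimately show ?thesis
    by simp
qed

subsection \<open>Cell searches\<close>

lemma cell_position_eq:
  "cell_position x \<delta> i = x + (if odd i then \<delta> * sgn x else 0)"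
  by (induction i) auto

lemma leg_searches_unit_speed:
  "leg_searches (Leg x (x + \<delta> * s) 1 M) m z \<tau> \<longleftrightarrow>
     m \<in> M \<and> 0 \<le> \<tau> \<and> \<tau> \<le> \<delta> \<and> z = x + \<tau> * s"
  if "\<bar>s\<bar> = 1" "\<delta> > 0"
  using that
  by (auto simp: leg_searches_def leg_duration_def leg_position_def abs_mult sgn_mult sgn_if abs_if
      split: if_splits)

lemma cell_search_nth:
  assumes "i < p"
  shows "cell_search x \<delta> p ! i =
    Leg (cell_position x \<delta> i) (cell_position x \<delta> i + \<delta> * ((-1) ^ i * sgn x)) 1 {i}"
  using assms by (simp add: cell_search_def mult_ac)

lemma total_duration_cell_search_take:
  assumes "x \<noteq> 0" "\<delta> \<ge> 0" "k \<le> p"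
  shows "total_duration (take k (cell_search x \<delta> p)) = real k * \<delta>"
proof -
  have "leg_duration (Leg (cell_position x \<delta> i) (cell_position x \<delta> (Suc i)) 1 {i}) = \<delta>" for i
    using assms by (simp add: leg_duration_def abs_mult)
  then show ?thesis
    using assms by (simp add: cell_search_def take_map total_duration_def o_def
        sum_list_triv del: cell_position.simps)
qed

lemma total_duration_cell_search:
  assumes "x \<noteq> 0" "\<delta> \<ge> 0"
  shows "total_duration (cell_search x \<delta> p) = real p * \<delta>"
  using total_duration_cell_search_take[OF assms order_refl[of p]] by (simp add: cell_search_def)

text \<open>Mode m is active only during the m-th traversal of the cell, which goes outwards for
  even m and back for odd m.\<close>

lemma searched_in_cell_search:
  assumes "x \<noteq> 0" "\<delta> > 0"
  shows "searched_in (cell_search x \<delta> p) m z t \<longleftrightarrow>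
    m < p \<and> (\<exists>\<tau>\<in>{0..\<delta>}. t = real m * \<delta> + \<tau> \<and>
      z = x + (if even m then \<tau> else \<delta> - \<tau>) * sgn x)"
proof -
  have "searched_in (cell_search x \<delta> p) m z t \<longleftrightarrow>
      (\<exists>k<p. leg_searches (cell_search x \<delta> p ! k) m z (t - real k * \<delta>))"
    using assms by (auto simp: searched_in_def cell_search_def[of x \<delta> p, THEN arg_cong[of _ _ length]]
        total_duration_cell_search_take)
  also have "\<dots> \<longleftrightarrow> m < p \<and> leg_searches (cell_search x \<delta> p ! m) m z (t - real m * \<delta>)"
    by (auto simp: cell_search_nth leg_searches_def)
  also have "\<dots> \<longleftrightarrow> m < p \<and> 0 \<le> t - real m * \<delta> \<and> t - real m * \<delta> \<le> \<delta> \<and>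
      z = cell_position x \<delta> m + (t - real m * \<delta>) * ((-1) ^ m * sgn x)"
    using assms by (auto simp: cell_search_nth leg_searches_unit_speed abs_mult power_abs)
  also have "\<dots> \<longleftrightarrow> m < p \<and> (\<exists>\<tau>\<in>{0..\<delta>}. t = real m * \<delta> + \<tau> \<and>
      z = x + (if even m then \<tau> else \<delta> - \<tau>) * sgn x)"
    by (auto simp: cell_position_eq algebra_simps intro!: bexI[of _ "t - real m * \<delta>"])
  finally show ?thesis .
qed


section \<open>Consecutive cell searches with end points x + E k in the direction of x\<close>

locale cell_sweep =
  fixes p :: nat and x :: real and E :: "nat \<Rightarrow> real" and n :: nat
  assumes odd_p: "odd p" and nonzero: "x \<noteq> 0"
    and n_pos: "n > 0" and E_0: "E 0 = 0" and E_less: "k < n \<Longrightarrow> E k < E (Suc k)"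
begin

abbreviation cell :: "nat \<Rightarrow> leg list" where
  "cell k \<equiv> cell_search (x + E k * sgn x) (E (Suc k) - E k) p"

text \<open>Since p is odd, each cell search ends at the far end of its cell, where the next one
  begins.\<close>

definition sweep :: "leg list" where
  "sweep = concat (map cell [0..<n])"

lemma E_mono: "j \<le> k \<Longrightarrow> k \<le> n \<Longrightarrow> E j \<le> E k"
proof (induction k rule: dec_induct)
  case (step k)
  then show ?case using E_less[of k] by simp
qed simp

lemma E_nonneg: "k \<le> n \<Longrightarrow> 0 \<le> E k"
  using E_mono[of 0 k] E_0 by simp

text \<open>A cell search takes its direction from its own starting point, which therefore has to
  stay on the side of x.\<close>

lemma sgn_shift: "0 \<le> e \<Longrightarrow> sgn (x + e * sgn x) = sgn x"
  using nonzero by (auto simp: sgn_if)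

lemma shift_nonzero: "0 \<le> e \<Longrightarrow> x + e * sgn x \<noteq> 0"
  using sgn_shift nonzero by (metis sgn_zero_iff)

lemma cells_duration:
  assumes "k \<le> n"
  shows "total_duration (concat (take k (map cell [0..<n]))) = real p * E k"
proof -
  have "total_duration (concat (take k (map cell [0..<n]))) = (\<Sum>j<k. total_duration (cell j))"
    using assms by (simp add: total_duration_concat take_map o_def interv_sum_list_conv_sum_set_nat
        atLeast0LessThan)
  also have "\<dots> = (\<Sum>j<k. real p * (E (Suc j) - E j))"
    using assms E_less E_nonneg
    by (intro sum.cong refl total_duration_cell_search shift_nonzero) (auto simp: less_imp_le)
  also have "\<dots> = real p * E k"
    using sum_lessThan_telescope[of E k] by (simp add: E_0 flip: sum_distrib_left)
  finally show ?thesis .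
qed

lemma sweep_duration: "total_duration sweep = real p * E n"
  using cells_duration[of n] by (simp add: sweep_def)

lemma sweep_final: "leg_end (last sweep) = x + E n * sgn x"
proof -
  obtain k where k: "n = Suc k"
    using n_pos by (cases n) auto
  obtain p' where p': "p = Suc p'"
    using odd_p by (cases p) auto
  have "last sweep = Leg (cell_position (x + E k * sgn x) (E n - E k) p')
      (cell_position (x + E k * sgn x) (E n - E k) p) 1 {p'}"
    unfolding sweep_def by (simp add: k p' cell_search_def last_append del: cell_position.simps)
  then show ?thesis
    using odd_p E_nonneg[of k] k by (simp add: cell_position_eq sgn_shift algebra_simps)
qed

lemma searched_in_sweep:
  "searched_in sweep m z t \<longleftrightarrow>
    m < p \<and> (\<exists>k<n. \<exists>\<tau>\<in>{0..E (Suc k) - E k}. t = real p * E k + real m * (E (Suc k) - E k) + \<tau> \<and>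
      z = x + (E k + (if even m then \<tau> else E (Suc k) - E k - \<tau>)) * sgn x)"
proof -
  have *: "searched_in (cell k) m z (t - real p * E k) \<longleftrightarrow>
      m < p \<and> (\<exists>\<tau>\<in>{0..E (Suc k) - E k}. t = real p * E k + real m * (E (Suc k) - E k) + \<tau> \<and>
        z = x + (E k + (if even m then \<tau> else E (Suc k) - E k - \<tau>)) * sgn x)" if "k < n" for k
    using that E_less[of k] E_nonneg[of k]
    by (subst searched_in_cell_search)
      (auto simp: shift_nonzero sgn_shift algebra_simps intro!: bexI)
  have "searched_in sweep m z t \<longleftrightarrow> (\<exists>k<n. searched_in (cell k) m z (t - real p * E k))"
    unfolding sweep_def searched_in_concat by (auto simp: cells_duration)
  then show ?thesis
    using * by blast
qed

lemma exists_cell: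
  assumes "0 \<le> u" "u \<le> E n"
  shows "\<exists>k<n. E k \<le> u \<and> u \<le> E (Suc k)"
proof -
  have "\<exists>k<l. E k \<le> u \<and> u \<le> E (Suc k)" if "l > 0" "u \<le> E l" for l
    using that
  proof (induction l)
    case (Suc l)
    show ?case
    proof (cases "l > 0 \<and> u \<le> E l")
      case True
      then show ?thesis using Suc.IH less_Suc_eq by auto
    next
      case False
      then have "E l \<le> u" using assms(1) E_0 by (cases "l = 0") auto
      then show ?thesis using Suc.prems by blast
    qed
  qed simp
  then show ?thesis
    using n_pos assms by blast
qed

text \<open>The bound is the time at which the last mode p - 1 arrives: p E(k) for the earlier
  cells, p - 1 traversals of cell k, and then u - E(k). No other mode is later.\<close>

lemma searched_in_sweep_early:
  assumes "m < p" "k < n" "E k \<le> u" "u \<le> E (Suc k)"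
  shows "\<exists>t\<le>(real p - 1) * E (Suc k) + u. searched_in sweep m (x + u * sgn x) t"
proof -
  define \<Delta> where "\<Delta> = E (Suc k) - E k"
  define \<tau> where "\<tau> = (if even m then u - E k else E (Suc k) - u)"
  define t where "t = real p * E k + real m * \<Delta> + \<tau>"
  have \<tau>: "\<tau> \<in> {0..\<Delta>}"
    using assms by (auto simp: \<tau>_def \<Delta>_def)
  then have "searched_in sweep m (x + u * sgn x) t"
    unfolding searched_in_sweep using assms(1,2)
    by (intro conjI exI[of _ k] bexI[of _ \<tau>]) (auto simp: t_def \<tau>_def \<Delta>_def)
  moreover have "real m * \<Delta> + \<tau> \<le> (real p - 1) * \<Delta> + (u - E k)"
  proof (cases "even m")
    case True
    then show ?thesis
      using assms \<tau> by (auto simp: \<tau>_def \<Delta>_def intro!: mult_right_mono)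
  next
    case False
    \<comment> \<open>An odd mode below the odd p is at most p - 2, so its traversal is complete
      before mode p - 1 starts.\<close>
    then have "m + 2 \<le> p"
      using assms(1) odd_p by presburger
    then have "real m * \<Delta> + \<Delta> \<le> (real p - 1) * \<Delta>"
      using \<tau> mult_right_mono[of "real m + 1" "real p - 1" \<Delta>] by (simp add: algebra_simps)
    then show ?thesis
      using \<tau> assms(3) by auto
  qed
  then have "t \<le> (real p - 1) * E (Suc k) + u"
    by (simp add: t_def \<Delta>_def algebra_simps)
  ultimately show ?thesis by blast
qed

text \<open>A point inside the first cell is not touched by later cells, and mode p - 1 starts there
  only after p - 1 traversals.\<close>

lemma searched_in_sweep_late:
  assumes "0 < u" "u < E 1" "searched_in sweep (p - 1) (x + u * sgn x) t"
  shows "(real p - 1) * E 1 \<le> t"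
proof -
  have p: "p > 0" "even (p - 1)"
    using odd_p by (auto simp: odd_pos)
  obtain k \<tau> where k: "k < n" and \<tau>: "\<tau> \<in> {0..E (Suc k) - E k}"
    and t: "t = real p * E k + real (p - 1) * (E (Suc k) - E k) + \<tau>"
    and z: "x + u * sgn x = x + (E k + \<tau>) * sgn x"
    using assms(3) p unfolding searched_in_sweep by auto
  have "u = E k + \<tau>"
    using z nonzero by (auto simp: sgn_eq_0_iff)
  then have "k = 0"
    using assms(2) \<tau> E_mono[of 1 k] k by (cases k) auto
  then show ?thesis
    using t \<tau> p by (simp add: E_0 of_nat_diff)
qed

end

text \<open>Closed form of the loop: X k is the length of k cells without truncation, E k cuts it
  off at \<delta>, and n is the first index at which X reaches \<delta>. Only the last cell can be
  truncated.\<close>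

lemma compliant_cells_eq:
  fixes \<delta> \<epsilon> c x :: real and p :: nat
  defines "q \<equiv> (c + \<epsilon> - 1) / (real p - 1)" and "s \<equiv> \<epsilon> * \<bar>x\<bar> / (real p - 1)"
  defines "X \<equiv> \<lambda>k. s * (\<Sum>j<k. q ^ j)"
  defines "E \<equiv> \<lambda>k. min (X k) \<delta>"
  assumes "q \<ge> 1" "s > 0" "\<delta> > 0"
  obtains n where "n > 0" "\<And>k. k < n \<Longrightarrow> X k < \<delta>" "\<delta> \<le> X n"
    "compliant_cells x \<delta> p c \<epsilon> = map (\<lambda>k. (x + E k * sgn x, E (Suc k) - E k)) [0..<n]"
proof -
  \<comment> \<open>Termination: since q is at least 1, every cell without truncation has length at
    least s, so X k is at least k s.\<close>
  have "\<exists>k. \<delta> \<le> X k"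
  proof -
    obtain k where k: "\<delta> < real k * s"
      using reals_Archimedean3[OF \<open>s > 0\<close>] by blast
    have "real k = (\<Sum>j<k. 1)" by simp
    also have "\<dots> \<le> (\<Sum>j<k. q ^ j)"
      using \<open>q \<ge> 1\<close> by (intro sum_mono) simp
    finally have "real k * s \<le> X k"
      using \<open>s > 0\<close> by (simp add: X_def mult.commute)
    then show ?thesis using k by (intro exI[of _ k]) simp
  qed
  define n where "n = (LEAST k. \<delta> \<le> X k)"
  have n: "\<delta> \<le> X n"
    unfolding n_def using \<open>\<exists>k. \<delta> \<le> X k\<close> by (rule LeastI_ex)
  have less: "X k < \<delta>" if "k < n" for k
    using that not_less_Least unfolding n_def by fastforce
  have X_Suc: "X (Suc k) = X k + s * q ^ k" for k
    by (simp add: X_def algebra_simps)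
  have "X 0 = 0"
    by (simp add: X_def)
  then have "n > 0"
    using n \<open>\<delta> > 0\<close> by (cases n) auto
  define state where
    "state = (\<lambda>k. (E k, s * q ^ k, map (\<lambda>k. (x + E k * sgn x, E (Suc k) - E k)) [0..<k]))"
  let ?b = "\<lambda>(y, s, cells). y < \<delta>"
  let ?c = "\<lambda>(y, s, cells). let \<Delta>x = min s (\<delta> - y)
     in (y + \<Delta>x, s * ((c + \<epsilon> - 1) / (real p - 1)), cells @ [(x + y * sgn x, \<Delta>x)])"
  \<comment> \<open>The induction runs downwards from n, where the loop condition fails; each
    earlier state is unfolded once into its successor.\<close>
  have "while ?b ?c (state k) = state n" if "k \<le> n" for k
    using that
  proof (induction k rule: inc_induct)
    case base
    show ?case
      using n by (subst while_unfold) (simp add: state_def E_def)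
  next
    case (step k)
    have "?b (state k)"
      using less[OF step.hyps(2)] by (simp add: state_def E_def)
    moreover have "?c (state k) = state (Suc k)"
    proof -
      \<comment> \<open>Below n there is no truncation yet, so E k = X k, and the minimum taken by
        the loop is the cut-off in E (Suc k).\<close>
      have "E (Suc k) = E k + min (s * q ^ k) (\<delta> - E k)"
        using less[OF step.hyps(2)] by (auto simp: E_def X_Suc min_def)
      then show ?thesis
        by (simp add: state_def Let_def flip: q_def)
    qed
    ultimately have "while ?b ?c (state k) = while ?b ?c (state (Suc k))"
      by (subst while_unfold) (simp only: if_True)
    then show ?case
      using step.IH by (simp only:)
  qed
  from this[of 0] have "while ?b ?c (0, s, []) = state n"
    using \<open>X 0 = 0\<close> \<open>\<delta> > 0\<close> by (simp add: state_def E_def)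
  then have "compliant_cells x \<delta> p c \<epsilon> = map (\<lambda>k. (x + E k * sgn x, E (Suc k) - E k)) [0..<n]"
    by (simp add: compliant_cells_def state_def flip: s_def)
  with that \<open>n > 0\<close> less n show thesis by blast
qed

subsection \<open>The compliant algorithm\<close>

locale compliant =
  fixes p :: nat and a \<epsilon> :: real
  assumes odd_p: "odd p" and p_ge: "3 \<le> p" and a_gt_1: "a > 1" and eps_pos: "\<epsilon> > 0"
begin

text \<open>The closed expression replaces \<open>ratio_A p\<close>, so that the analysis applies to
  every growth factor; the two agree for \<open>growth p\<close>.\<close>

definition c :: real where
  "c = round_search.ratio p a"

definition q :: real where
  "q = (c + \<epsilon> - 1) / (real p - 1)"

abbreviation extent :: "real \<Rightarrow> real" where
  "extent x \<equiv> (a\<^sup>2 - 1) * \<bar>x\<bar>"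

definition full_cells_end :: "real \<Rightarrow> nat \<Rightarrow> real" where
  "full_cells_end x k = \<epsilon> * \<bar>x\<bar> / (real p - 1) * (\<Sum>j<k. q ^ j)"

definition cells_end :: "real \<Rightarrow> nat \<Rightarrow> real" where
  "cells_end x k = min (full_cells_end x k) (extent x)"

lemma c_ge: "2 * (real p - 1) \<le> c - 1"
  unfolding c_def using round_search.ratio_ge_double[OF round_search_thorough] a_gt_1 p_ge by auto

lemma q_ge: "2 \<le> q"
  using c_ge p_ge eps_pos by (simp add: q_def field_simps)

text \<open>Multiplied by p - 1, this recurrence is the equality case of the condition for ratio c +
  eps.\<close>

lemma full_cells_end_Suc:
  "full_cells_end x (Suc k) = q * full_cells_end x k + \<epsilon> * \<bar>x\<bar> / (real p - 1)"
proof -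
  have "(\<Sum>j<Suc k. q ^ j) = q * (\<Sum>j<k. q ^ j) + 1"
    by (subst sum.lessThan_Suc_shift) (simp add: sum_distrib_left)
  then show ?thesis
    unfolding full_cells_end_def by (simp only:) (simp add: algebra_simps)
qed

text \<open>
  The cell lengths grow at the largest rate that keeps every point within ratio
  \<open>c + \<epsilon>\<close>; for untruncated cells the bound is an equality.
\<close>

lemma cells_end_Suc_le:
  assumes "full_cells_end x k < extent x"
  shows "(real p - 1) * cells_end x (Suc k) \<le> (c + \<epsilon> - 1) * cells_end x k + \<epsilon> * \<bar>x\<bar>"
proof -
  have "(real p - 1) * cells_end x (Suc k) \<le> (real p - 1) * full_cells_end x (Suc k)"
    using p_ge by (intro mult_left_mono) (auto simp: cells_end_def)
  also have "\<dots> = (c + \<epsilon> - 1) * full_cells_end x k + \<epsilon> * \<bar>x\<bar>"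
    using p_ge by (simp add: full_cells_end_Suc q_def distrib_left)
  also have "full_cells_end x k = cells_end x k"
    using assms by (simp add: cells_end_def)
  finally show ?thesis .
qed

text \<open>Turns the loop into a sweep. The cell ends increase strictly even at a truncated last
  cell, because that cell still begins before the end of the round.\<close>

lemma compliant_sweep:
  assumes x: "x \<noteq> 0"
  obtains n where "cell_sweep p x (cells_end x) n"
    "\<And>k. k < n \<Longrightarrow> full_cells_end x k < extent x"
    "cells_end x n = extent x"
    "length (compliant_cells x (extent x) p c \<epsilon>) = n"
    "compliant_thorough_search x (extent x) p c \<epsilon> = cell_sweep.sweep p x (cells_end x) n"
proof -
  have "(c + \<epsilon> - 1) / (real p - 1) \<ge> 1" "\<epsilon> * \<bar>x\<bar> / (real p - 1) > 0" "extent x > 0"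
    using q_ge eps_pos p_ge x a_gt_1 by (auto simp flip: q_def)
  from compliant_cells_eq[OF this, folded q_def, folded full_cells_end_def, folded cells_end_def]
  obtain n where n: "n > 0" "\<And>k. k < n \<Longrightarrow> full_cells_end x k < extent x"
    "extent x \<le> full_cells_end x n"
    and cells: "compliant_cells x (extent x) p c \<epsilon> =
      map (\<lambda>k. (x + cells_end x k * sgn x, cells_end x (Suc k) - cells_end x k)) [0..<n]"
    by blast
  have sweep: "cell_sweep p x (cells_end x) n"
  proof
    show "cells_end x 0 = 0"
      using \<open>extent x > 0\<close> by (simp add: cells_end_def full_cells_end_def)
    fix k
    assume "k < n"
    have "full_cells_end x k < full_cells_end x (Suc k)"
      unfolding full_cells_end_def
      by (intro mult_strict_left_mono) (use x eps_pos p_ge q_ge in auto)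
    then show "cells_end x k < cells_end x (Suc k)"
      using n(2)[OF \<open>k < n\<close>] by (auto simp: cells_end_def)
  qed (use odd_p x n in auto)
  moreover have "compliant_thorough_search x (extent x) p c \<epsilon> = cell_sweep.sweep p x (cells_end x) n"
    by (simp add: compliant_thorough_search_def cell_sweep.sweep_def[OF sweep] cells o_def)
  moreover have "cells_end x n = extent x"
    using n by (simp add: cells_end_def)
  ultimately show thesis
    using that n cells by simp
qed

lemma scale_eq: "x + (v - 1) * \<bar>x\<bar> * sgn x = v * x" for x v :: real
  by (simp add: algebra_simps abs_sgn)

lemma round_search_compliant:
  "round_search p a (\<lambda>x \<delta>. compliant_thorough_search x \<delta> p c \<epsilon>)"
proof
  fix x :: real
  assume x: "x \<noteq> 0"
  obtain n where "cell_sweep p x (cells_end x) n" and n: "cells_end x n = extent x"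
    and eq: "compliant_thorough_search x (extent x) p c \<epsilon> = cell_sweep.sweep p x (cells_end x) n"
    using compliant_sweep[OF x] by metis
  then interpret cell_sweep p x "cells_end x" n by simp
  show "total_duration (compliant_thorough_search x (extent x) p c \<epsilon>) = real p * extent x"
    by (simp add: eq sweep_duration n)
  show "leg_end (last (compliant_thorough_search x (extent x) p c \<epsilon>)) = a\<^sup>2 * x"
    by (simp add: eq sweep_final n scale_eq)
  show "\<exists>v\<in>{1..a\<^sup>2}. z = v * x"
    if s: "searched_in (compliant_thorough_search x (extent x) p c \<epsilon>) m z t" for m z t
  proof -
    obtain k \<tau> where k: "k < n" and \<tau>: "\<tau> \<in> {0..cells_end x (Suc k) - cells_end x k}"
      and z: "z = x + (cells_end x k +
        (if even m then \<tau> else cells_end x (Suc k) - cells_end x k - \<tau>)) * sgn x"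
      using s unfolding eq searched_in_sweep by blast
    define e where
      "e = cells_end x k + (if even m then \<tau> else cells_end x (Suc k) - cells_end x k - \<tau>)"
    have z: "z = x + e * sgn x" and e: "cells_end x k \<le> e" "e \<le> cells_end x (Suc k)"
      using z \<tau> by (auto simp: e_def)
    have e': "0 \<le> e" "e \<le> extent x"
      using k e E_nonneg[of k] E_mono[of "Suc k" n] n by auto
    have "z = (1 + e / \<bar>x\<bar>) * x"
      using x scale_eq[of x "1 + e / \<bar>x\<bar>"] z by simp
    moreover have "1 + e / \<bar>x\<bar> \<in> {1..a\<^sup>2}"
      using x e' by (simp add: field_simps)
    ultimately show ?thesis by blast
  qed
qed (use p_ge a_gt_1 in auto)

text \<open>At offset u = (v-1) |x| in cell k, every mode arrives by (p-1) E(k+1) + u. The growth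
  condition bounds this by (c+eps) u + eps |x|, which equals the time allowed by
  \<open>ratio_upper_bound\<close>.\<close>

lemma compliant_ratio_le: "competitive_ratio p (compliant_algorithm p a c \<epsilon>) \<le> ereal (c + \<epsilon>)"
proof -
  interpret round_search p a "\<lambda>x \<delta>. compliant_thorough_search x \<delta> p c \<epsilon>"
    by (rule round_search_compliant)
  have "ratio = c"
    by (simp add: c_def)
  show ?thesis
    unfolding compliant_algorithm_def
  proof (rule ratio_upper_bound[unfolded \<open>ratio = c\<close>])
    fix x v :: real and m
    assume x: "x \<noteq> 0" and v: "v \<in> {1..a\<^sup>2}" and m: "m < p"
    obtain n where "cell_sweep p x (cells_end x) n" and n: "cells_end x n = extent x"
      and less: "\<And>k. k < n \<Longrightarrow> full_cells_end x k < extent x"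
      and eq: "compliant_thorough_search x (extent x) p c \<epsilon> = cell_sweep.sweep p x (cells_end x) n"
      using compliant_sweep[OF x] by metis
    then interpret cell_sweep p x "cells_end x" n by simp
    let ?u = "(v - 1) * \<bar>x\<bar>"
    have "0 \<le> ?u" "?u \<le> cells_end x n"
      unfolding n using v by (auto intro!: mult_right_mono)
    then obtain k where k: "k < n" "cells_end x k \<le> ?u" "?u \<le> cells_end x (Suc k)"
      using exists_cell by blast
    have "(real p - 1) * cells_end x (Suc k) \<le> (c + \<epsilon> - 1) * cells_end x k + \<epsilon> * \<bar>x\<bar>"
      using cells_end_Suc_le less k(1) by blast
    also have "\<dots> \<le> (c + \<epsilon> - 1) * ?u + \<epsilon> * \<bar>x\<bar>"
      using k(2) c_ge eps_pos p_ge by (intro add_right_mono mult_left_mono) auto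
    finally have "(real p - 1) * cells_end x (Suc k) + ?u \<le> ((c + \<epsilon>) * v - c) * \<bar>x\<bar>"
      by (simp add: algebra_simps)
    then show "\<exists>t\<le>((c + \<epsilon>) * v - c) * \<bar>x\<bar>.
        searched_in (compliant_thorough_search x (extent x) p c \<epsilon>) m (v * x) t"
      using searched_in_sweep_early[OF m k] unfolding eq scale_eq by (meson order_trans)
  qed (use eps_pos in simp)
qed

text \<open>The assumption says that the first cell, of length eps |x| / (p-1), fits into the round.
  Mode p - 1 is then delayed on its interior by p - 1 traversals, that is by eps |x|.\<close>

lemma compliant_ratio_ge:
  assumes "\<epsilon> \<le> (real p - 1) * (a\<^sup>2 - 1)"
  shows "ereal (c + \<epsilon>) \<le> competitive_ratio p (compliant_algorithm p a c \<epsilon>)"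
proof -
  interpret round_search p a "\<lambda>x \<delta>. compliant_thorough_search x \<delta> p c \<epsilon>"
    by (rule round_search_compliant)
  let ?\<theta> = "\<epsilon> / (real p - 1)"
  have "ratio = c"
    by (simp add: c_def)
  show ?thesis
    unfolding compliant_algorithm_def
  proof (rule ratio_lower_bound[unfolded \<open>ratio = c\<close>])
    show "0 < ?\<theta>" "?\<theta> \<le> a\<^sup>2 - 1" "p - 1 < p"
      using assms eps_pos p_ge by (auto simp: field_simps)
    fix x v t
    assume x: "x \<noteq> 0" and v: "v \<in> {1<..<1 + ?\<theta>}"
      and s: "searched_in (compliant_thorough_search x (extent x) p c \<epsilon>) (p - 1) (v * x) t"
    obtain n where "cell_sweep p x (cells_end x) n"
      and eq: "compliant_thorough_search x (extent x) p c \<epsilon> = cell_sweep.sweep p x (cells_end x) n"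
      using compliant_sweep[OF x] by metis
    then interpret cell_sweep p x "cells_end x" n by simp
    have "?\<theta> * \<bar>x\<bar> \<le> extent x"
      using \<open>?\<theta> \<le> a\<^sup>2 - 1\<close> by (intro mult_right_mono) auto
    then have first: "cells_end x 1 = ?\<theta> * \<bar>x\<bar>"
      by (simp add: cells_end_def full_cells_end_def)
    have "(v - 1) * \<bar>x\<bar> < ?\<theta> * \<bar>x\<bar>"
      by (rule mult_strict_right_mono) (use v x in auto)
    moreover have "0 < (v - 1) * \<bar>x\<bar>"
      using v x by simp
    ultimately have "(real p - 1) * cells_end x 1 \<le> t"
      using searched_in_sweep_late[of "(v - 1) * \<bar>x\<bar>" t] s unfolding eq scale_eq first by simp
    then show "\<epsilon> * \<bar>x\<bar> \<le> t"
      using p_ge unfolding first by simp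
  qed
qed

text \<open>The last cell begins before the end of the round, so the geometric sum of the n - 1
  preceding cells stays below a^2 - 1 relative to |x|. This bounds q^(n-1), and q is at least
  2.\<close>

lemma number_of_cells:
  assumes "x \<noteq> 0"
  shows "2 ^ (length (compliant_cells x (extent x) p c \<epsilon>) - 1) \<le>
    1 + (a\<^sup>2 - 1) * (c + \<epsilon> - p) / \<epsilon>"
proof -
  obtain n where sweep: "cell_sweep p x (cells_end x) n"
    and less: "\<And>k. k < n \<Longrightarrow> full_cells_end x k < extent x"
    and len: "length (compliant_cells x (extent x) p c \<epsilon>) = n"
    using compliant_sweep[OF assms] by metis
  have "3 \<le> real p"
    using p_ge by simp
  have "n - 1 < n"
    using cell_sweep.n_pos[OF sweep] by simp
  from less[OF this] have "\<epsilon> / (real p - 1) * (\<Sum>j<n - 1. q ^ j) * \<bar>x\<bar> < (a\<^sup>2 - 1) * \<bar>x\<bar>"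
    by (simp add: full_cells_end_def mult_ac)
  then have "\<epsilon> / (real p - 1) * (\<Sum>j<n - 1. q ^ j) < a\<^sup>2 - 1"
    by (rule mult_right_less_imp_less) simp
  moreover have "(\<Sum>j<n - 1. q ^ j) = (q ^ (n - 1) - 1) / (q - 1)"
    using q_ge by (simp add: geometric_sum)
  moreover have "(q - 1) * (real p - 1) = c + \<epsilon> - p"
    using p_ge by (simp add: q_def field_simps)
  moreover have "c + \<epsilon> - p > 0"
    using c_ge eps_pos \<open>3 \<le> real p\<close> by simp
  ultimately have "\<epsilon> * (q ^ (n - 1) - 1) / (c + \<epsilon> - p) < a\<^sup>2 - 1"
    by (simp add: mult.commute)
  then have "q ^ (n - 1) \<le> 1 + (a\<^sup>2 - 1) * (c + \<epsilon> - p) / \<epsilon>"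
    using \<open>c + \<epsilon> - p > 0\<close> eps_pos by (simp add: field_simps)
  moreover have "2 ^ (n - 1) \<le> q ^ (n - 1)"
    using q_ge by (intro power_mono) auto
  ultimately show ?thesis
    by (simp add: len)
qed

end

subsection \<open>The optimal growth factor\<close>

lemma growth_gt_1: "growth p > 1"
  by (simp add: growth_def)

lemma growth_le_2: "p > 0 \<Longrightarrow> growth p \<le> 2"
  by (simp add: growth_def)

text \<open>With b = a - 1 and (p+1) b^2 = 2, the numerator of the ratio becomes 4 + 2 (p+1) b. As 4
  = sqrt(8(p+1)) b, the factor b cancels.\<close>

lemma ratio_growth:
  assumes "p > 0"
  shows "round_search.ratio p (growth p) = 2 * real p + 3 + sqrt (8 * (real p + 1))"
proof -
  interpret round_search p "growth p" "\<lambda>x \<delta>. thorough_search x \<delta> p"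
    using assms growth_gt_1 by (rule round_search_thorough)
  define b where "b = sqrt (2 / (real p + 1))"
  have b: "b > 0"
    by (simp add: b_def)
  have b2: "(real p + 1) * b\<^sup>2 = 2"
    using assms by (simp add: b_def divide_eq_eq)
  have "sqrt (8 * (real p + 1)) * b = sqrt (8 * (real p + 1) * (2 / (real p + 1)))"
    unfolding b_def by (rule real_sqrt_mult[symmetric])
  also have "8 * (real p + 1) * (2 / (real p + 1)) = 4\<^sup>2"
    using assms by (simp add: divide_eq_eq)
  finally have root: "sqrt (8 * (real p + 1)) * b = 4"
    by simp
  have "(real p + 1) * (1 + b)\<^sup>2 - (real p - 1) = 2 + 2 * (real p + 1) * b + (real p + 1) * b\<^sup>2"
    by (simp add: power2_eq_square algebra_simps)
  also have "\<dots> = (2 * (real p + 1) + sqrt (8 * (real p + 1))) * b"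
    using b2 root by (simp add: distrib_right)
  finally show ?thesis
    using b unfolding ratio_def by (simp add: growth_def flip: b_def)
qed

lemma competitive_ratio_alg_A:
  "p > 0 \<Longrightarrow> competitive_ratio p (alg_A p) = ereal (2 * real p + 3 + sqrt (8 * (real p + 1)))"
  by (simp add: alg_A_def competitive_ratio_odd_algorithm growth_gt_1 ratio_growth)

lemma ratio_A_eq: "p > 0 \<Longrightarrow> ratio_A p = 2 * real p + 3 + sqrt (8 * (real p + 1))"
  by (simp add: ratio_A_def competitive_ratio_alg_A)

text \<open>The maximum with 1 is there because every round makes at least one call, while the
  logarithm may be small or negative. The constant 19 is 4 + 15 from the estimate of 2^N
  below.\<close>

lemma calls_B_le:
  assumes "odd p" "3 \<le> p" "0 < \<epsilon>"
  shows "real (calls_B p \<epsilon> i) \<le> (1 + (ln 19 + 1) / ln 2) * max 1 (ln (real p / \<epsilon>))"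
proof -
  interpret compliant p "growth p" \<epsilon>
    using assms growth_gt_1 by unfold_locales
  define L where "L = max 1 (ln (real p / \<epsilon>))"
  define N where "N = calls_B p \<epsilon> i - 1"
  have c: "c = ratio_A p" "c = 2 * real p + 3 + sqrt (8 * (real p + 1))"
    using assms by (simp_all add: c_def ratio_growth ratio_A_eq)
  \<comment> \<open>The bound 4 p - 3 is chosen so that c - p is at most 5 p.\<close>
  have "sqrt (8 * (real p + 1)) \<le> 4 * real p - 3"
  proof (rule real_le_lsqrt)
    have "0 \<le> 16 * (real p * (real p - 2)) + 1"
      using assms by simp
    then show "8 * (real p + 1) \<le> (4 * real p - 3)\<^sup>2"
      by (simp add: power2_eq_square algebra_simps)
  qed (use assms in auto)
  then have c_le: "c + \<epsilon> - p \<le> 5 * real p + \<epsilon>"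
    by (simp add: c(2))
  have "(growth p)\<^sup>2 \<le> 2\<^sup>2"
    using growth_gt_1[of p] growth_le_2[of p] assms by (intro power_mono) auto
  then have g: "(growth p)\<^sup>2 - 1 \<le> 3"
    by simp
  have "2 ^ N \<le> 1 + ((growth p)\<^sup>2 - 1) * (c + \<epsilon> - p) / \<epsilon>"
    using number_of_cells[of "round_start (growth p) i"] growth_gt_1[of p]
    by (simp add: N_def calls_B_def cell_search_calls_def round_extent_eq round_start_eq flip: c(1))
  also have "\<dots> \<le> 1 + 3 * (5 * real p + \<epsilon>) / \<epsilon>"
    using g c_le c_ge assms by (intro add_left_mono divide_right_mono mult_mono) auto
  also have "\<dots> = 4 + 15 * (real p / \<epsilon>)"
    using assms by (simp add: field_simps)
  also have "\<dots> \<le> 19 * max 1 (real p / \<epsilon>)"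
    by simp
  finally have "ln (2 ^ N) \<le> ln (19 * max 1 (real p / \<epsilon>))"
    by (subst ln_le_cancel_iff) auto
  also have "\<dots> = ln 19 + max 0 (ln (real p / \<epsilon>))"
    using assms by (auto simp: ln_mult max_def)
  \<comment> \<open>Uses that L is at least 1 and dominates the positive part of the
    logarithm.\<close>
  also have "\<dots> \<le> ln 19 * L + L"
    by (intro add_mono) (auto simp: L_def)
  finally have "real N * ln 2 \<le> (ln 19 + 1) * L"
    by (simp add: ln_realpow algebra_simps)
  then have "real N \<le> (ln 19 + 1) / ln 2 * L"
    by (simp add: field_simps)
  moreover have "real (calls_B p \<epsilon> i) \<le> 1 + real N"
    by (simp add: N_def)
  moreover have "1 \<le> L"
    by (simp add: L_def)
  ultimately show ?thesis
    unfolding L_def[symmetric] by (simp add: distrib_right)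
qed

text \<open>The logarithm vanishes at p = eps, so it dominates the constant 1 only when p / eps
  stays at least some K > 1; the factor is then 1 / ln K, or 1 if that is larger.\<close>

lemma max_1_ln_bigo:
  assumes "K > 1"
  shows "(\<lambda>(p, \<epsilon>, i). max 1 (ln (real p / \<epsilon>)))
    \<in> O[principal {(p, \<epsilon>, i). odd p \<and> 3 \<le> p \<and> 0 < \<epsilon> \<and> K \<le> real p / \<epsilon>}](\<lambda>(p, \<epsilon>, i).
        ln (real p / \<epsilon>))"
proof (rule bigoI[of _ "max 1 (1 / ln K)"])
  have "norm (max 1 (ln z)) \<le> max 1 (1 / ln K) * norm (ln z)" if "K \<le> z" for z
  proof -
    have "0 < ln K" "ln K \<le> ln z"
      using assms that by auto
    then have "1 * ln z \<le> max 1 (1 / ln K) * ln z" "1 / ln K * ln z \<le> max 1 (1 / ln K) * ln z"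
      by (intro mult_right_mono; simp)+
    moreover have "1 \<le> 1 / ln K * ln z"
      using \<open>0 < ln K\<close> \<open>ln K \<le> ln z\<close> by simp
    ultimately have "1 \<le> max 1 (1 / ln K) * ln z" "ln z \<le> max 1 (1 / ln K) * ln z"
      by (blast intro: order_trans, simp only: mult_1)
    then show ?thesis
      using \<open>0 < ln K\<close> \<open>ln K \<le> ln z\<close> by simp
  qed
  then show "\<forall>\<^sub>F x in principal {(p, \<epsilon>, i). odd p \<and> 3 \<le> p \<and> 0 < \<epsilon> \<and> K \<le> real p / \<epsilon>}.
      norm (case x of (p, \<epsilon>, i) \<Rightarrow> max 1 (ln (real p / \<epsilon>)))
      \<le> max 1 (1 / ln K) * norm (case x of (p, \<epsilon>, i) \<Rightarrow> ln (real p / \<epsilon>))"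
    by (auto simp only: eventually_principal)
qed

text \<open>The condition on eps says that the first cell fits into the round; for larger eps a
  round is one truncated cell. The principal filters make the constants uniform in p, eps and the
  round i. The logarithm alone is used where p / eps stays away from 1, and its maximum with 1
  covers all eps > 0.\<close>

theorem theorem6:
  "(\<forall>p. odd p \<and> 3 \<le> p \<longrightarrow>
      competitive_ratio p (alg_A p) = ereal (2 * real p + 3 + sqrt (8 * (real p + 1)))) \<and>
   (\<forall>p \<epsilon>. odd p \<and> 3 \<le> p \<and> 0 < \<epsilon> \<longrightarrow>
      competitive_ratio p (alg_B p \<epsilon>) \<le> competitive_ratio p (alg_A p) + ereal \<epsilon> \<and>
      (\<epsilon> \<le> (real p - 1) * (growth p ^ 2 - 1) \<longrightarrow>
        competitive_ratio p (alg_B p \<epsilon>) = competitive_ratio p (alg_A p) + ereal \<epsilon>)) \<and>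
   (\<forall>K>1. (\<lambda>(p, \<epsilon>, i). real (calls_B p \<epsilon> i))
      \<in> O[principal {(p, \<epsilon>, i). odd p \<and> 3 \<le> p \<and> 0 < \<epsilon> \<and> K \<le> real p / \<epsilon>}](\<lambda>(p, \<epsilon>, i).
          ln (real p / \<epsilon>))) \<and>
   (\<lambda>(p, \<epsilon>, i). real (calls_B p \<epsilon> i))
      \<in> O[principal {(p, \<epsilon>, i). odd p \<and> 3 \<le> p \<and> 0 < \<epsilon>}](\<lambda>(p, \<epsilon>, i).
          max 1 (ln (real p / \<epsilon>)))"
proof (intro conjI allI impI)
  show "competitive_ratio p (alg_A p) = ereal (2 * real p + 3 + sqrt (8 * (real p + 1)))"
    if "odd p \<and> 3 \<le> p" for p
    using that by (simp add: competitive_ratio_alg_A)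
next
  fix p :: nat and \<epsilon> :: real
  assume *: "odd p \<and> 3 \<le> p \<and> 0 < \<epsilon>"
  then interpret compliant p "growth p" \<epsilon>
    using growth_gt_1 by unfold_locales auto
  have c: "ratio_A p = c" "competitive_ratio p (alg_A p) = ereal c"
    using * by (simp_all add: c_def ratio_growth ratio_A_eq competitive_ratio_alg_A)
  show le: "competitive_ratio p (alg_B p \<epsilon>) \<le> competitive_ratio p (alg_A p) + ereal \<epsilon>"
    using compliant_ratio_le by (simp add: alg_B_def c)
  show "competitive_ratio p (alg_B p \<epsilon>) = competitive_ratio p (alg_A p) + ereal \<epsilon>"
    if "\<epsilon> \<le> (real p - 1) * (growth p ^ 2 - 1)"
    using le compliant_ratio_ge[OF that] by (intro antisym) (auto simp: alg_B_def c)
next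
  show bigo: "(\<lambda>(p, \<epsilon>, i). real (calls_B p \<epsilon> i))
      \<in> O[principal {(p, \<epsilon>, i). odd p \<and> 3 \<le> p \<and> 0 < \<epsilon>}](\<lambda>(p, \<epsilon>, i).
          max 1 (ln (real p / \<epsilon>)))"
    by (rule bigoI[of _ "1 + (ln 19 + 1) / ln 2"])
      (auto simp: eventually_principal calls_B_le)
  fix K :: real
  assume "1 < K"
  have "principal {(p, \<epsilon>, i). odd p \<and> 3 \<le> p \<and> 0 < \<epsilon> \<and> K \<le> real p / \<epsilon>} \<le>
      principal {(p, \<epsilon> :: real, i :: nat). odd p \<and> 3 \<le> p \<and> 0 < \<epsilon>}"
    by auto
  from landau_o.big.filter_mono'[OF this] bigo
  have "(\<lambda>(p, \<epsilon>, i). real (calls_B p \<epsilon> i))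
      \<in> O[principal {(p, \<epsilon>, i). odd p \<and> 3 \<le> p \<and> 0 < \<epsilon> \<and> K \<le> real p / \<epsilon>}](\<lambda>(p, \<epsilon>, i).
          max 1 (ln (real p / \<epsilon>)))"
    by blast
  also note max_1_ln_bigo[OF \<open>1 < K\<close>]
  finally show "(\<lambda>(p, \<epsilon>, i). real (calls_B p \<epsilon> i))
      \<in> O[principal {(p, \<epsilon>, i). odd p \<and> 3 \<le> p \<and> 0 < \<epsilon> \<and> K \<le> real p / \<epsilon>}](\<lambda>(p, \<epsilon>, i).
          ln (real p / \<epsilon>))" .
qed

end
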